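(* Let $T$ be a tree of order $n\ge 3$ and let $v$ be a vertex of $T$. If $T$ is not NEB at $v$, then no $A\in S^-(T)$ has the Duarte property with respect to the vertex $v$.
   Context: For a real skew-symmetric matrix $A=[a_{i,j}]$ of order $n$, its graph $G(A)$ has vertex set $\{1,\ldots,n\}$ and edge set $\{\{i,j\}: a_{i,j}\ne 0,\ i<j\}$. $S^-(T)$ is the set of all real skew-symmetric matrices whose graph is $T$. For a vertex $w$ of a tree $T$, $T(w)$ is the forest obtained by deleting $w$; for a neighbor $v$ of $w$, $T_v(w)$ is the connected component of $T(w)$ containing $v$. For $A\in S^-(T)$, $A(w)$ and $A_v(w)$ denote the principal submatrices of $A$ corresponding to $T(w)$ and $T_v(w)$ (rows and columns keep their vertex labels). Order on $\mathrm{i}\mathbb{R}$: $a\le b$ means $-\mathrm{i}a\le-\mathrm{i}b$ as real numbers. Spectra of real skew-symmetric matrices (contained in $\mathrm{i}\mathbb{R}$) are listed with multiplicity in increasing order; $\{\mu_1,\ldots,\mu_{n-1}\}$ strictly interlaces $\{\lambda_1,\ldots,\lambda_n\}$ if $\lambda_1<\mu_1<\lambda_2<\cdots<\mu_{n-1}<\lambda_n$. Duarte property (recursive): let $A$ be a matrix whose graph is a tree and $w$ a vertex of $G(A)$. If $G(A)$ has just one vertex, $A$ has the Duarte property with respect to $w$. If $G(A)$ has more than one vertex, $A$ has the Duarte property with respect to $w$ provided the eigenvalues of $A(w)$ strictly interlace those of $A$ and, for each neighbor $v$ of $w$, $A_v(w)$ has the Duarte property with respect to $v$. NEB (nearly even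 branching; recursive): let $T$ be a tree on $n$ vertices and $w$ a vertex of $T$. If $n=1$, $T$ is NEB at $w$. If $n\ge2$, $T$ is NEB at $w$ if (i) $T(w)$ has exactly one odd component (a connected component with an odd number of vertices) when $n$ is even, and no odd component when $n$ is odd; and (ii) for each neighbor $v$ of $w$ in $T$, $T_v(w)$ is NEB at $v$. *)

theory Defs
  imports
    "HOL-Computational_Algebra.Polynomial"
    "HOL-Library.Multiset"
    "Jordan_Normal_Form.Char_Poly"
    "Jordan_Normal_Form.DL_Submatrix"
begin

section \<open>Simple graphs and trees\<close>

text \<open>
  The notion of tree in the AFP entry Graph-Theory is not suitable for undirected graphs: there the
  two orientations of one edge already form a cycle. So a simple graph is taken to be a pair of a
  vertex set and a set of two-element edges.
\<close>

type_synonym 'a sgraph = "'a set \<times> 'a set set"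

abbreviation verts :: "'a sgraph \<Rightarrow> 'a set" where
  "verts G \<equiv> fst G"

abbreviation edges :: "'a sgraph \<Rightarrow> 'a set set" where
  "edges G \<equiv> snd G"

definition simple_graph :: "'a sgraph \<Rightarrow> bool" where
  "simple_graph G \<longleftrightarrow> finite (verts G) \<and>
     (\<forall>e \<in> edges G. \<exists>u \<in> verts G. \<exists>v \<in> verts G. u \<noteq> v \<and> e = {u, v})"

definition neighbors :: "'a sgraph \<Rightarrow> 'a \<Rightarrow> 'a set" where
  "neighbors G w = {v \<in> verts G. {w, v} \<in> edges G}"

definition induced :: "'a sgraph \<Rightarrow> 'a set \<Rightarrow> 'a sgraph" where
  "induced G U = (verts G \<inter> U, {e \<in> edges G. e \<subseteq> U})"

definition delete_vertex :: "'a sgraph \<Rightarrow> 'a \<Rightarrow> 'a sgraph" where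
  "delete_vertex G w = induced G (verts G - {w})"

text \<open>Connected components are represented by their vertex sets.\<close>

definition component :: "'a sgraph \<Rightarrow> 'a \<Rightarrow> 'a set" where
  "component G v = {u \<in> verts G. (v, u) \<in> {(x, y). {x, y} \<in> edges G}\<^sup>*}"

definition components :: "'a sgraph \<Rightarrow> 'a set set" where
  "components G = component G ` verts G"

definition connected_graph :: "'a sgraph \<Rightarrow> bool" where
  "connected_graph G \<longleftrightarrow> verts G \<noteq> {} \<and> (\<forall>u \<in> verts G. component G u = verts G)"

definition is_cycle :: "'a sgraph \<Rightarrow> 'a list \<Rightarrow> bool" where
  "is_cycle G c \<longleftrightarrow> 3 \<le> length c \<and> distinct c \<and> set c \<subseteq> verts G \<and>
     (\<forall>i < length c. {c ! i, c ! (Suc i mod length c)} \<in> edges G)"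

definition tree :: "'a sgraph \<Rightarrow> bool" where
  "tree G \<longleftrightarrow> simple_graph G \<and> connected_graph G \<and> \<not> (\<exists>c. is_cycle G c)"

text \<open>The vertex set of \<open>G\<^sub>v(w)\<close>.\<close>

definition branch_verts :: "'a sgraph \<Rightarrow> 'a \<Rightarrow> 'a \<Rightarrow> 'a set" where
  "branch_verts G w v = component (delete_vertex G w) v"

definition odd_components :: "'a sgraph \<Rightarrow> 'a set set" where
  "odd_components G = {C \<in> components G. odd (card C)}"


section \<open>Nearly even branching\<close>

text \<open>
  This is meant for trees only. On finite graphs the branches are strictly smaller than the graph,
  so the inductive definition is the intended recursion.
\<close>

inductive NEB :: "'a sgraph \<Rightarrow> 'a \<Rightarrow> bool" where
  single: "w \<in> verts T \<Longrightarrow> card (verts T) = 1 \<Longrightarrow> NEB T w"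
| step: "w \<in> verts T \<Longrightarrow> card (verts T) \<ge> 2 \<Longrightarrow>
    card (odd_components (delete_vertex T w)) = (if even (card (verts T)) then 1 else 0) \<Longrightarrow>
    (\<And>v. v \<in> neighbors T w \<Longrightarrow> NEB (induced T (branch_verts T w v)) v) \<Longrightarrow>
    NEB T w"


section \<open>Skew-symmetric matrices and their graphs\<close>

text \<open>
  Rows and columns of an \<open>n \<times> n\<close> matrix are indexed by \<open>0, \<dots>, n - 1\<close>, which are also the vertices
  of its graph. A principal submatrix is given by the original matrix \<open>A\<close> together with the set \<open>S\<close>
  of the rows and columns kept. This way the labels survive, whereas \<^const>\<open>submatrix\<close> renumbers
  the rows and columns; it is used below only for the spectrum, where the labels do not matter.
\<close>

definition graph_on :: "real mat \<Rightarrow> nat set \<Rightarrow> nat sgraph" where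
  "graph_on A S = (S, {{i, j} | i j. i \<in> S \<and> j \<in> S \<and> i < j \<and> A $$ (i, j) \<noteq> 0})"

definition matrix_graph :: "real mat \<Rightarrow> nat sgraph" where
  "matrix_graph A = graph_on A {..<dim_row A}"

definition skew_matrices :: "nat sgraph \<Rightarrow> real mat set" where
  "skew_matrices T = {A. square_mat A \<and> transpose_mat A = - A \<and> matrix_graph A = T}"


section \<open>Spectra and strict interlacing\<close>

definition spectrum_mset :: "real mat \<Rightarrow> complex multiset" where
  "spectrum_mset A = proots (char_poly (map_mat complex_of_real A))"

text \<open>
  The order on the imaginary axis: for \<open>a\<close> purely imaginary, \<open>- \<i> * a\<close> is real.
\<close>

definition le_imag :: "complex \<Rightarrow> complex \<Rightarrow> bool" where
  "le_imag a b \<longleftrightarrow> Re (- \<i> * a) \<le> Re (- \<i> * b)"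

definition less_imag :: "complex \<Rightarrow> complex \<Rightarrow> bool" where
  "less_imag a b \<longleftrightarrow> Re (- \<i> * a) < Re (- \<i> * b)"

definition strictly_interlaces :: "complex multiset \<Rightarrow> complex multiset \<Rightarrow> bool" where
  "strictly_interlaces M L \<longleftrightarrow> (\<exists>ms ls.
     mset ms = M \<and> sorted_wrt le_imag ms \<and> mset ls = L \<and> sorted_wrt le_imag ls \<and>
     length ls = length ms + 1 \<and>
     (\<forall>k < length ms. less_imag (ls ! k) (ms ! k) \<and> less_imag (ms ! k) (ls ! (k + 1))))"


section \<open>The Duarte property\<close>

text \<open>
  \<open>duarte_on A S w\<close> says that the principal submatrix of \<open>A\<close> on \<open>S\<close>, whose graph is meant to be a
  tree, has the Duarte property with respect to the vertex \<open>w\<close>. For a finite set \<open>S\<close> the branches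
  are strictly smaller than \<open>S\<close>, so the inductive definition is the intended recursion.
\<close>

inductive duarte_on :: "real mat \<Rightarrow> nat set \<Rightarrow> nat \<Rightarrow> bool" for A :: "real mat" where
  single: "w \<in> S \<Longrightarrow> card S = 1 \<Longrightarrow> duarte_on A S w"
| step: "w \<in> S \<Longrightarrow> card S \<ge> 2 \<Longrightarrow>
    strictly_interlaces (spectrum_mset (submatrix A (S - {w}) (S - {w})))
                        (spectrum_mset (submatrix A S S)) \<Longrightarrow>
    (\<And>v. v \<in> neighbors (graph_on A S) w \<Longrightarrow>
       duarte_on A (branch_verts (graph_on A S) w v) v) \<Longrightarrow>
    duarte_on A S w"

definition duarte :: "real mat \<Rightarrow> nat \<Rightarrow> bool" where
  "duarte A w \<longleftrightarrow> duarte_on A {..<dim_row A} w"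

end

theory Submission
  imports Defs
begin

text \<open>
  Strict interlacing forces the eigenvalues of \<open>A(w)\<close> to be simple. A skew-symmetric matrix of odd
  order is singular, and the spectrum of \<open>A(w)\<close> is the sum of the spectra of its branches, so every
  odd component of \<open>T(w)\<close> contributes to the multiplicity of the eigenvalue \<open>0\<close>. Hence there is at
  most one odd component, and the parity of \<open>n - 1\<close> decides whether it exists; this is the
  condition of NEB at \<open>w\<close>. The branches are handled by the recursion.
\<close>

subsection \<open>Characteristic polynomials of principal submatrices\<close>

text \<open>Permuting rows and columns alike brings in the sign of \<open>p\<close> twice, and the
  two signs cancel. Columns are permuted as rows of the transpose.\<close>

lemma det_permute_rows_cols:
  fixes A :: "'a :: comm_ring_1 mat"
  assumes A: "A \<in> carrier_mat n n" and p: "p permutes {0..<n}"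
  shows "det (mat n n (\<lambda>(i, j). A $$ (p i, p j))) = det A"
proof -
  let ?R = "mat n n (\<lambda>(i, j). A $$ (p i, j))"
  let ?C = "mat n n (\<lambda>(i, j). transpose_mat ?R $$ (p i, j))"
  have less: "p i < n" if "i < n" for i
    using permutes_in_image[OF p, of i] that by simp
  have "mat n n (\<lambda>(i, j). A $$ (p i, p j)) = transpose_mat ?C"
    by (rule eq_matI) (auto simp: less)
  also have "det \<dots> = det ?C"
    by (rule det_transpose[of _ n]) simp
  also have "\<dots> = signof p * det (transpose_mat ?R)"
    by (rule det_permute_rows[OF _ p]) simp
  also have "det (transpose_mat ?R) = signof p * det A"
    using det_transpose[of ?R n] det_permute_rows[OF A p] by simp
  finally show ?thesis
    by (simp add: sign_def)
qed

lemma char_poly_permute: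
  fixes A :: "'a :: comm_ring_1 mat"
  assumes A: "A \<in> carrier_mat n n" and p: "p permutes {0..<n}"
  shows "char_poly (mat n n (\<lambda>(i, j). A $$ (p i, p j))) = char_poly A"
proof -
  have less: "p i < n" if "i < n" for i
    using permutes_in_image[OF p, of i] that by simp
  \<comment> \<open>Injectivity of \<open>p\<close> keeps the diagonal on the diagonal, so the
    entries carrying the variable end up where they should.\<close>
  have "char_poly_matrix (mat n n (\<lambda>(i, j). A $$ (p i, p j))) =
      mat n n (\<lambda>(i, j). char_poly_matrix A $$ (p i, p j))"
    using A permutes_inj[OF p] by (intro eq_matI) (auto simp: char_poly_matrix_def less inj_eq)
  then show ?thesis
    unfolding char_poly_def using det_permute_rows_cols[OF char_poly_matrix_closed[OF A] p] by simp
qed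

lemma char_poly_four_block_diag:
  fixes A B :: "'a :: idom mat"
  assumes A: "A \<in> carrier_mat n n" and B: "B \<in> carrier_mat m m"
  shows "char_poly (four_block_mat A (0\<^sub>m n m) (0\<^sub>m m n) B) = char_poly A * char_poly B"
proof -
  have "char_poly_matrix (four_block_mat A (0\<^sub>m n m) (0\<^sub>m m n) B) =
      four_block_mat (char_poly_matrix A) (0\<^sub>m n m) (0\<^sub>m m n) (char_poly_matrix B)"
    using A B by (intro eq_matI) (auto simp: char_poly_matrix_def)
  then show ?thesis
    unfolding char_poly_def
    using det_four_block_mat_upper_right_zero[OF char_poly_matrix_closed[OF A] refl _
        char_poly_matrix_closed[OF B]] by simp
qed

text \<open>The index \<open>i\<close> is recovered from \<open>pick S i\<close> as the number of
  elements of \<open>S\<close> below it, which gives injectivity; comparing cardinalities gives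
  surjectivity.\<close>

lemma bij_betw_pick:
  assumes "finite S"
  shows "bij_betw (pick S) {0..<card S} S"
proof -
  have inj: "inj_on (pick S) {0..<card S}"
    by (rule inj_onI) (metis atLeastLessThan_iff card_pick)
  moreover have "pick S ` {0..<card S} \<subseteq> S"
    by (auto simp: pick_in_set)
  ultimately have "pick S ` {0..<card S} = S"
    using assms by (simp add: card_image card_subset_eq)
  with inj show ?thesis
    by (simp add: bij_betw_def)
qed

lemma submatrix_principal_eq:
  assumes "A \<in> carrier_mat n n" "S \<subseteq> {..<n}"
  shows "submatrix A S S = mat (card S) (card S) (\<lambda>(i, j). A $$ (pick S i, pick S j))"
proof -
  have "{i. i < n \<and> i \<in> S} = S"
    using assms by auto
  then show ?thesis
    using assms by (simp add: submatrix_def)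
qed

lemma submatrix_principal_carrier:
  assumes "A \<in> carrier_mat n n" "S \<subseteq> {..<n}"
  shows "submatrix A S S \<in> carrier_mat (card S) (card S)"
  by (simp add: submatrix_principal_eq[OF assms])

text \<open>Enumerating \<open>S\<close> in another order only conjugates the submatrix by a permutation.\<close>

lemma char_poly_submatrix_enum:
  fixes A :: "'a :: comm_ring_1 mat"
  assumes A: "A \<in> carrier_mat n n" and S: "S \<subseteq> {..<n}" and f: "bij_betw f {0..<card S} S"
  shows "char_poly (mat (card S) (card S) (\<lambda>(i, j). A $$ (f i, f j))) = char_poly (submatrix A S S)"
proof -
  let ?g = "inv_into {0..<card S} (pick S)"
  \<comment> \<open>The change of enumeration from \<open>f\<close> to \<open>pick S\<close>,
    extended by the identity because \<open>permutes\<close> demands fixed points outside the index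
    range.\<close>
  define p where "p i = (if i < card S then ?g (f i) else i)" for i
  have fin: "finite S"
    using S finite_subset by blast
  have "bij_betw (?g \<circ> f) {0..<card S} {0..<card S}"
    using f bij_betw_inv_into[OF bij_betw_pick[OF fin]] bij_betw_trans by blast
  then have "bij_betw p {0..<card S} {0..<card S}"
    by (rule bij_betw_cong[THEN iffD1, rotated]) (simp add: p_def)
  then have p: "p permutes {0..<card S}"
    by (rule bij_imp_permutes) (simp add: p_def)
  have less: "p i < card S" if "i < card S" for i
    using permutes_in_image[OF p, of i] that by simp
  have pick: "pick S (p i) = f i" if "i < card S" for i
    using that bij_betw_pick[OF fin] bij_betwE[OF f]
    by (simp add: p_def bij_betw_inv_into_right)
  have "mat (card S) (card S) (\<lambda>(i, j). A $$ (f i, f j)) =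
      mat (card S) (card S) (\<lambda>(i, j). submatrix A S S $$ (p i, p j))"
    by (rule eq_matI) (auto simp: submatrix_principal_eq[OF A S] less pick)
  then show ?thesis
    using char_poly_permute[OF submatrix_principal_carrier[OF A S] p] by simp
qed

text \<open>Listing \<open>U\<close> first and \<open>V\<close> afterwards makes the matrix block
  diagonal. \<open>submatrix\<close> itself enumerates the union increasingly and may mix the two
  sets, hence the passage through another enumeration \<open>f\<close>.\<close>

lemma char_poly_submatrix_Un:
  fixes A :: "'a :: idom mat"
  assumes A: "A \<in> carrier_mat n n" and UV: "U \<subseteq> {..<n}" "V \<subseteq> {..<n}" "U \<inter> V = {}"
    and zero: "\<And>i j. i \<in> U \<Longrightarrow> j \<in> V \<Longrightarrow> A $$ (i, j) = 0 \<and> A $$ (j, i) = 0"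
  shows "char_poly (submatrix A (U \<union> V) (U \<union> V)) =
    char_poly (submatrix A U U) * char_poly (submatrix A V V)"
proof -
  let ?u = "card U" and ?v = "card V"
  define f where "f i = (if i < ?u then pick U i else pick V (i - ?u))" for i
  have fin: "finite U" "finite V"
    using UV finite_subset by blast+
  have card: "card (U \<union> V) = ?u + ?v"
    using fin UV by (simp add: card_Un_disjoint)
  have "bij_betw f {0..<?u} U"
    using bij_betw_pick[OF fin(1)] by (rule bij_betw_cong[THEN iffD1, rotated]) (simp add: f_def)
  moreover have "bij_betw f {?u..<?u + ?v} V"
  proof -
    have "bij_betw (\<lambda>i. i - ?u) {?u..<?u + ?v} {0..<?v}"
      by (rule bij_betw_byWitness[where f' = "\<lambda>i. i + ?u"]) auto
    then have "bij_betw (pick V \<circ> (\<lambda>i. i - ?u)) {?u..<?u + ?v} V"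
      using bij_betw_pick[OF fin(2)] bij_betw_trans by blast
    then show ?thesis
      by (rule bij_betw_cong[THEN iffD1, rotated]) (simp add: f_def)
  qed
  ultimately have "bij_betw f ({0..<?u} \<union> {?u..<?u + ?v}) (U \<union> V)"
    using UV by (intro bij_betw_combine)
  moreover have "{0..<?u} \<union> {?u..<?u + ?v} = {0..<card (U \<union> V)}"
    using card by auto
  ultimately have f: "bij_betw f {0..<card (U \<union> V)} (U \<union> V)"
    by simp
  have pick: "i < ?u \<Longrightarrow> pick U i \<in> U" "\<not> i < ?u \<Longrightarrow> i < ?u + ?v \<Longrightarrow> pick V (i - ?u) \<in> V" for i
    by (auto intro!: pick_in_set)
  have "mat (card (U \<union> V)) (card (U \<union> V)) (\<lambda>(i, j). A $$ (f i, f j)) =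
      four_block_mat (submatrix A U U) (0\<^sub>m ?u ?v) (0\<^sub>m ?v ?u) (submatrix A V V)"
    using UV
    by (intro eq_matI)
      (auto simp: submatrix_principal_eq[OF A] card f_def zero pick)
  then show ?thesis
    using char_poly_submatrix_enum[OF A _ f] UV
      char_poly_four_block_diag[OF submatrix_principal_carrier[OF A] submatrix_principal_carrier[OF A]]
    by simp
qed

subsection \<open>Spectra of skew-symmetric matrices\<close>

lemma spectrum_mset_eq:
  assumes "A \<in> carrier_mat n n"
  shows "spectrum_mset A = proots (map_poly complex_of_real (char_poly A))"
  by (simp add: spectrum_mset_def of_real_hom.char_poly_hom[OF assms])

lemma char_poly_nonzero:
  fixes A :: "'a :: idom mat"
  assumes "A \<in> carrier_mat n n"
  shows "char_poly A \<noteq> 0"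
  using degree_monic_char_poly[OF assms] by auto

text \<open>The multiset of roots of a product of nonzero polynomials is the sum of the root
  multisets of the factors.\<close>

lemma spectrum_submatrix_Un:
  assumes A: "A \<in> carrier_mat n n" and UV: "U \<subseteq> {..<n}" "V \<subseteq> {..<n}" "U \<inter> V = {}"
    and zero: "\<And>i j. i \<in> U \<Longrightarrow> j \<in> V \<Longrightarrow> A $$ (i, j) = 0 \<and> A $$ (j, i) = 0"
  shows "spectrum_mset (submatrix A (U \<union> V) (U \<union> V)) =
    spectrum_mset (submatrix A U U) + spectrum_mset (submatrix A V V)"
proof -
  interpret of_real_poly: map_poly_comm_ring_hom complex_of_real ..
  note carrier = submatrix_principal_carrier[OF A]
  have nz: "map_poly complex_of_real (char_poly (submatrix A S S)) \<noteq> 0" if "S \<subseteq> {..<n}" for S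
    using char_poly_nonzero[OF carrier[OF that]] by simp
  have "U \<union> V \<subseteq> {..<n}"
    using UV by simp
  from spectrum_mset_eq[OF carrier[OF this]] show ?thesis
    using char_poly_submatrix_Un[OF A UV zero] nz UV
    by (simp add: spectrum_mset_eq[OF carrier] of_real_poly.hom_mult proots_mult)
qed

text \<open>Transposing preserves the determinant, while negating a matrix of odd order changes its
  sign; so \<open>det A\<close> equals its own negative.\<close>

lemma det_skew_odd:
  fixes A :: "real mat"
  assumes A: "A \<in> carrier_mat n n" and skew: "transpose_mat A = - A" and "odd n"
  shows "det A = 0"
proof -
  have "- A = (- 1) \<cdot>\<^sub>m A"
    using A by (intro eq_matI) auto
  then have "det A = (- 1) ^ n * det A"
    using det_transpose[OF A] skew A by simp
  with \<open>odd n\<close> show ?thesis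
    by simp
qed

lemma zero_in_spectrum_skew_odd:
  assumes A: "A \<in> carrier_mat n n" and skew: "transpose_mat A = - A" and "odd n"
  shows "0 \<in># spectrum_mset A"
proof -
  \<comment> \<open>The characteristic polynomial at 0 is the determinant of
    \<open>- char_matrix A 0\<close>, that is, of \<open>- A\<close>, and this vanishes together
    with \<open>det A\<close>.\<close>
  have "char_matrix A 0 = A"
    using A by (intro eq_matI) (auto simp: char_matrix_def)
  then have "poly (char_poly A) 0 = 0"
    using char_poly_matrix[OF A, of 0] det_0_negate[OF A] det_skew_odd[OF assms] by simp
  then have "poly (map_poly complex_of_real (char_poly A)) 0 = 0"
    using of_real_hom.poly_map_poly[of "char_poly A" 0, where ?'a = complex] by simp
  then show ?thesis
    using char_poly_nonzero[OF A] by (simp add: spectrum_mset_eq[OF A])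
qed

lemma transpose_submatrix_skew:
  fixes A :: "'a :: ring_1 mat"
  assumes A: "A \<in> carrier_mat n n" and skew: "transpose_mat A = - A" and S: "S \<subseteq> {..<n}"
  shows "transpose_mat (submatrix A S S) = - submatrix A S S"
proof -
  have skew': "A $$ (j, i) = - A $$ (i, j)" if "i < n" "j < n" for i j
    using arg_cong[OF skew, of "\<lambda>M. M $$ (i, j)"] that A by simp
  have less: "pick S i < n" if "i < card S" for i
    using S pick_in_set[of i S] that by auto
  show ?thesis
  proof (rule eq_matI)
    fix i j
    assume "i < dim_row (- submatrix A S S)" "j < dim_col (- submatrix A S S)"
    then have ij: "i < card S" "j < card S"
      by (simp_all add: submatrix_principal_eq[OF A S])
    have "A $$ (pick S j, pick S i) = - A $$ (pick S i, pick S j)"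
      by (rule skew'[OF less[OF ij(1)] less[OF ij(2)]])
    with ij show "transpose_mat (submatrix A S S) $$ (i, j) = (- submatrix A S S) $$ (i, j)"
      by (simp add: submatrix_principal_eq[OF A S])
  qed (simp_all add: submatrix_principal_eq[OF A S])
qed

lemma zero_in_spectrum_submatrix:
  assumes A: "A \<in> carrier_mat n n" and skew: "transpose_mat A = - A"
    and S: "S \<subseteq> {..<n}" and "odd (card S)"
  shows "0 \<in># spectrum_mset (submatrix A S S)"
  by (rule zero_in_spectrum_skew_odd[OF submatrix_principal_carrier[OF A S]
        transpose_submatrix_skew[OF A skew S] \<open>odd (card S)\<close>])

text \<open>For \<open>i < j\<close>, the entries \<open>ls ! (i + 1)\<close> and
  \<open>ls ! j\<close> lie strictly between \<open>ms ! i\<close> and \<open>ms ! j\<close>, so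
  \<open>ms\<close> has no repetition.\<close>

lemma strictly_interlaces_count_le_1:
  assumes "strictly_interlaces M L"
  shows "count M x \<le> 1"
proof -
  obtain ms ls where M: "mset ms = M" and ls: "sorted_wrt le_imag ls"
    and len: "length ls = length ms + 1"
    and inter: "\<forall>k < length ms. less_imag (ls ! k) (ms ! k) \<and> less_imag (ms ! k) (ls ! (k + 1))"
    using assms unfolding strictly_interlaces_def by (elim exE conjE) (rule that)
  have "ms ! i \<noteq> ms ! j" if ij: "i < j" "j < length ms" for i j
  proof -
    \<comment> \<open>Sortedness compares distinct positions only, so the case
      \<open>i + 1 = j\<close> is settled by reflexivity.\<close>
    have 1: "le_imag (ls ! (i + 1)) (ls ! j)"
    proof (cases "i + 1 = j")
      case True
      then show ?thesis by (simp add: le_imag_def)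
    next
      case False
      with ij have "i + 1 < j" by simp
      moreover have "j < length ls" using ij len by simp
      ultimately show ?thesis
        by (rule sorted_wrt_nth_less[OF ls])
    qed
    have "less_imag (ms ! i) (ls ! (i + 1))" "less_imag (ls ! j) (ms ! j)"
      using inter ij by simp_all
    with 1 have "less_imag (ms ! i) (ms ! j)"
      unfolding le_imag_def less_imag_def by linarith
    then show ?thesis
      by (auto simp: less_imag_def)
  qed
  then have "ms ! i \<noteq> ms ! j" if "i < length ms" "j < length ms" "i \<noteq> j" for i j
    using that by (metis nat_neq_iff)
  then have "distinct ms"
    by (simp add: distinct_conv_nth)
  then show ?thesis
    unfolding M[symmetric] distinct_count_atmost_1 by simp
qed

subsection \<open>Components\<close>

lemma sym_edge_rel: "sym {(x, y). {x, y} \<in> E}"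
  by (rule symI) (simp add: insert_commute)

text \<open>Edges are unordered, so reachability is symmetric, and \<open>x\<close> and
  \<open>v\<close> reach the same vertices.\<close>

lemma component_eq:
  assumes "x \<in> component G v"
  shows "component G x = component G v"
proof -
  let ?R = "{(x, y). {x, y} \<in> edges G}\<^sup>*"
  have vx: "(v, x) \<in> ?R"
    using assms by (simp add: component_def)
  then have xv: "(x, v) \<in> ?R"
    by (rule symD[OF sym_rtrancl[OF sym_edge_rel]])
  have "(x, u) \<in> ?R \<longleftrightarrow> (v, u) \<in> ?R" for u
    using vx xv by (auto intro: rtrancl_trans)
  then show ?thesis
    by (simp add: component_def)
qed

lemma component_eq_of_mem:
  assumes "C \<in> components G" "i \<in> C"
  shows "component G i = C"
proof -
  obtain v where "C = component G v"
    using assms by (auto simp: components_def)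
  with assms show ?thesis
    using component_eq[of i G v] by simp
qed

lemma disjoint_components:
  assumes "C \<in> components G" "D \<in> components G" "C \<noteq> D"
  shows "C \<inter> D = {}"
  using assms component_eq_of_mem by (metis disjoint_iff)

lemma Union_components: "\<Union> (components G) = verts G"
  by (auto simp: components_def component_def)

lemma component_closed:
  assumes "C \<in> components G" "i \<in> C" "{i, j} \<in> edges G" "j \<in> verts G"
  shows "j \<in> C"
proof -
  have "j \<in> component G i"
    using assms by (auto simp: component_def)
  also have "component G i = C"
    using assms by (simp add: component_eq_of_mem)
  finally show ?thesis .
qed

text \<open>The components partition the vertices, and a sum of natural numbers has the parity of
  the number of its odd terms.\<close>

lemma even_card_verts_iff:
  assumes "finite (verts G)"
  shows "even (card (verts G)) \<longleftrightarrow> even (card (odd_components G))"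
proof -
  have fin: "finite (components G)"
    using assms by (simp add: components_def)
  have "finite C" if "C \<in> components G" for C
    using that assms by (auto simp: components_def component_def)
  then have "card (\<Union> (components G)) = (\<Sum>C \<in> components G. card C)"
    by (intro card_Union_disjoint) (auto simp: pairwise_def disjnt_def disjoint_components)
  then show ?thesis
    using fin by (simp add: Union_components even_sum_iff odd_components_def)
qed

text \<open>Keeps branches in the form \<open>graph_on A U\<close> with the same \<open>A\<close>,
  so that the recursions of \<open>NEB\<close> and \<open>duarte_on\<close> run over the same vertex
  sets.\<close>

lemma induced_graph_on:
  assumes "U \<subseteq> S"
  shows "induced (graph_on A S) U = graph_on A U"
  using assms unfolding induced_def graph_on_def by auto

lemma delete_vertex_graph_on: "delete_vertex (graph_on A S) w = graph_on A (S - {w})"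
  unfolding delete_vertex_def by (subst induced_graph_on) (auto simp: graph_on_def)

lemma branch_verts_subset: "branch_verts G w v \<subseteq> verts G"
  by (auto simp: branch_verts_def component_def delete_vertex_def induced_def)

subsection \<open>Odd branches of a matrix with the Duarte property\<close>

text \<open>A nonzero entry would be an edge leaving the component \<open>C\<close>, although
  components are closed under adjacency.\<close>

lemma skew_entry_zero_between_components:
  assumes A: "A \<in> carrier_mat n n" and skew: "transpose_mat A = - A" and S: "S \<subseteq> {..<n}"
    and C: "C \<in> components (graph_on A S)" and ij: "i \<in> C" "j \<in> S - C"
  shows "A $$ (i, j) = 0 \<and> A $$ (j, i) = 0"
proof -
  have "i \<in> S"
    using Union_components[of "graph_on A S"] C ij by (auto simp: graph_on_def)
  then have less: "i < n" "j < n"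
    using S ij by auto
  then have eq: "A $$ (j, i) = - A $$ (i, j)"
    using arg_cong[OF skew, of "\<lambda>M. M $$ (i, j)"] A by simp
  have "{i, j} \<notin> edges (graph_on A S)"
    using component_closed[OF C ij(1), of j] ij by (auto simp: graph_on_def)
  \<comment> \<open>\<open>graph_on\<close> reads edges off the entries above the diagonal; when
    \<open>j < i\<close>, skew symmetry moves the nonzero entry there.\<close>
  moreover have "{i, j} \<in> edges (graph_on A S)" if "A $$ (i, j) \<noteq> 0"
  proof (cases "i < j")
    case True
    with that show ?thesis
      using \<open>i \<in> S\<close> ij by (auto simp: graph_on_def)
  next
    case False
    moreover have "i \<noteq> j"
      using ij by auto
    ultimately have "j < i \<and> A $$ (j, i) \<noteq> 0 \<and> {i, j} = {j, i}"
      using that eq by auto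
    then show ?thesis
      using \<open>i \<in> S\<close> ij by (auto simp: graph_on_def)
  qed
  ultimately show ?thesis
    using eq by auto
qed

text \<open>Two distinct odd components \<open>C\<close> and \<open>D\<close> would split the matrix
  into independent blocks on \<open>C\<close>, on \<open>D\<close> and on the rest. The first two
  blocks are singular, so 0 would have multiplicity at least 2.\<close>

lemma card_odd_components_le_count:
  assumes A: "A \<in> carrier_mat n n" and skew: "transpose_mat A = - A" and S: "S \<subseteq> {..<n}"
    and count: "count (spectrum_mset (submatrix A S S)) 0 \<le> 1"
  shows "card (odd_components (graph_on A S)) \<le> 1"
proof (rule ccontr)
  let ?G = "graph_on A S"
  let ?spec = "\<lambda>U. spectrum_mset (submatrix A U U)"
  assume "\<not> ?thesis"
  \<comment> \<open>\<open>card_le_Suc0_iff_eq\<close> asks for a finite set; an infinite one has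
    \<open>card\<close> 0 and cannot violate the bound.\<close>
  then obtain C D where "C \<in> odd_components ?G" "D \<in> odd_components ?G" "C \<noteq> D"
    using card_le_Suc0_iff_eq[of "odd_components ?G"] by (metis One_nat_def card.infinite le0)
  then have C: "C \<in> components ?G" "odd (card C)" and D: "D \<in> components ?G" "odd (card D)"
    and "C \<noteq> D"
    by (auto simp: odd_components_def)
  have sub: "C \<subseteq> S" "D \<subseteq> S"
    using C D Union_components[of ?G] by (auto simp: graph_on_def)
  have disj: "C \<inter> D = {}"
    using disjoint_components C D \<open>C \<noteq> D\<close> by blast
  have "?spec (C \<union> (S - C)) = ?spec C + ?spec (S - C)"
    using skew_entry_zero_between_components[OF A skew S C(1)] S sub
    by (intro spectrum_submatrix_Un[OF A]) auto
  also have "C \<union> (S - C) = S"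
    using sub by auto
  also have "S - C = D \<union> (S - C - D)"
    using sub disj by auto
  also have "?spec (D \<union> (S - C - D)) = ?spec D + ?spec (S - C - D)"
    using skew_entry_zero_between_components[OF A skew S D(1)] S sub
    by (intro spectrum_submatrix_Un[OF A]) auto
  finally have "?spec S = ?spec C + (?spec D + ?spec (S - C - D))" .
  moreover have "0 \<in># ?spec C" "0 \<in># ?spec D"
    using zero_in_spectrum_submatrix[OF A skew] C D sub S by blast+
  ultimately have "count (?spec S) 0 \<ge> 2"
    by (simp flip: count_greater_zero_iff)
  with count show False
    by simp
qed

text \<open>Rule induction with \<open>A\<close> fixed and the vertex set \<open>S\<close> varying,
  so that the induction hypothesis applies to the branches at \<open>w\<close>.\<close>

lemma NEB_if_duarte_on:
  assumes "duarte_on A S w" and A: "A \<in> carrier_mat n n" and skew: "transpose_mat A = - A"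
    and "S \<subseteq> {..<n}"
  shows "NEB (graph_on A S) w"
  using assms(1,4)
proof (induction rule: duarte_on.induct)
  case (single w S)
  then show ?case
    by (simp add: NEB.single graph_on_def)
next
  case (step w S)
  let ?G = "graph_on A S" and ?H = "graph_on A (S - {w})"
  have fin: "finite S" and sub: "S - {w} \<subseteq> {..<n}"
    using step.prems finite_subset[OF step.prems] by blast+
  have verts: "verts ?G = S" "verts ?H = S - {w}"
    by (simp_all add: graph_on_def)
  have "card (odd_components ?H) \<le> 1"
    by (rule card_odd_components_le_count[OF A skew sub
          strictly_interlaces_count_le_1[OF step.hyps(3)]])
  moreover have "even (card (S - {w})) \<longleftrightarrow> even (card (odd_components ?H))"
    using even_card_verts_iff[of ?H] fin unfolding verts by simp
  moreover have "even (card (S - {w})) \<longleftrightarrow> odd (card S)"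
    using step.hyps(1,2) by simp
  \<comment> \<open>The bound leaves only the values 0 and 1, and the parity of
    \<open>card (S - {w})\<close> selects one of them.\<close>
  ultimately have odd: "card (odd_components ?H) = (if even (card S) then 1 else 0)"
    by (simp add: le_Suc_eq) presburger
  have "NEB (induced ?G (branch_verts ?G w v)) v" if "v \<in> neighbors ?G w" for v
  proof -
    have "branch_verts ?G w v \<subseteq> S"
      using branch_verts_subset[of ?G w v] unfolding verts .
    then show ?thesis
      using step.IH[OF that subset_trans[OF _ step.prems]] by (simp only: induced_graph_on)
  qed
  then show ?case
    by (rule NEB.step[of w ?G, unfolded verts delete_vertex_graph_on,
          OF step.hyps(1,2) odd])
qed

theorem theorem2p5:
  fixes T :: "nat sgraph" and n v :: nat
  assumes "tree T"
    and "verts T = {..<n}"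
    and "n \<ge> 3"
    and "v \<in> verts T"
    and "\<not> NEB T v"
  shows "\<not> (\<exists>A \<in> skew_matrices T. duarte A v)"
proof
  assume "\<exists>A \<in> skew_matrices T. duarte A v"
  then obtain A where *: "A \<in> skew_matrices T" and D: "duarte A v"
    by blast
  have sk: "square_mat A" "transpose_mat A = - A" "matrix_graph A = T"
    using * unfolding skew_matrices_def by blast+
  have A: "A \<in> carrier_mat (dim_row A) (dim_row A)"
    using sk(1) by (intro carrier_matI) simp_all
  have "NEB (graph_on A {..<dim_row A}) v"
    using D unfolding duarte_def by (rule NEB_if_duarte_on[OF _ A sk(2) order.refl])
  then show False
    using \<open>\<not> NEB T v\<close> unfolding sk(3)[symmetric] matrix_graph_def by (rule notE[rotated])
qed
end
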